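(* Let $\eta^2=-3$ and let $X_\eta=\{a^4+a^2e_2(u_1,\dots,u_5)+e_4(u_1,\dots,u_5)=0\}$ in the hyperplane $L_\eta:\ u_1+\cdots+u_5=\eta a$ of $\mathbb{P}^5$, a model of the Burkhardt quartic. For $i=1,\dots,5$ let $F_i=(a+u_i=0)$ and $G_i=(a-u_i=0)$, as hyperplanes of $L_\eta\cong\mathbb{P}^4$, and let $\Pi_{ij}=F_i\cap G_j$ for $i\ne j$. Then for every $i=1,\dots,5$, $$F_i\cap X_\eta=\bigcup_{j\neq i}\Pi_{ij}\qquad\text{and}\qquad G_i\cap X_\eta=\bigcup_{j\neq i}\Pi_{ji}.$$ Moreover, each of the hyperplanes $F_i$ and $G_i$ contains exactly eighteen nodes of $X_\eta$. Hence these ten hyperplanes are Steiner hyperplanes of the Burkhardt quartic.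
   Context: We work over $\mathbb{C}$; $e_r$ is the elementary symmetric polynomial of degree $r$, and $a,u_1,\dots,u_5$ are homogeneous coordinates on $\mathbb{P}^5$. The Burkhardt quartic is the quartic threefold $\{\sigma_1(x_0,\dots,x_5)=\sigma_4(x_0,\dots,x_5)=0\}\subset\mathbb{P}^5$ ($\sigma_r$ elementary symmetric polynomials in six variables), up to projective equivalence; it has exactly $45$ singular points, all nodes, and $X_\eta$ is projectively equivalent to it. A Steiner hyperplane of the Burkhardt quartic is a hyperplane (of the ambient $\mathbb{P}^4$) containing exactly eighteen of its nodes; classically, each Steiner hyperplane cuts the quartic in a union of four Jacobi planes (planes contained in the quartic and containing exactly nine nodes), and there are exactly forty Steiner hyperplanes. The forty-five nodes of $X_\eta$ are the following points $[a:u_1:\dots:u_5]$ of $L_\eta$. (i) For a partition $\{1,\dots,5\}=A\sqcup B\sqcup\{c\}$ with $|A|=|B|=2$, $R_{A,B;c}$ has $a=1$, $u_i=-1$ for $i\in A$, $u_j=1$ for $j\in B$, $u_c=\eta$. (ii) For $C=\{p,q\}\subset\{1,\dots,5\}$ with $p\ne q$, $T_C$ has $a=0$, $u_i=0$ for $i\notin C$, $u_p=1$, $u_q=-1$. (iii) For $c\in\{1,\dots,5\}$, $E_c$ has $a=1$, $u_c=-\eta/3$, $u_i=\eta/3$ for $i\neq c$. *)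

theory Defs
  imports "HOL-Analysis.Analysis"
begin

text \<open>Linear subspaces of projective space and hypersurfaces in them. A point is a line through
  the origin, and \<open>proj_space V\<close> is \<open>P(V)\<close> for a linear subspace \<open>V\<close> of \<open>\<complex>\<^sup>n\<close>.\<close>

definition proj_space :: "(complex ^ 'n) set \<Rightarrow> (complex ^ 'n) set set" where
  "proj_space V = {vec.span {v} | v. v \<in> V \<and> v \<noteq> 0}"

definition hypersurface ::
    "(complex ^ 'n) set \<Rightarrow> (complex ^ 'n \<Rightarrow> complex) \<Rightarrow> (complex ^ 'n) set set" where
  "hypersurface V f = {p \<in> proj_space V. \<forall>x\<in>p. f x = 0}"

definition is_hyperplane :: "(complex ^ 'n) set \<Rightarrow> (complex ^ 'n) set set \<Rightarrow> bool" where
  "is_hyperplane V H \<longleftrightarrow>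
     (\<exists>h. Vector_Spaces.linear (*s) (*) h \<and> (\<exists>x\<in>V. h x \<noteq> 0) \<and> H = hypersurface V h)"

definition dir_deriv :: "(complex ^ 'n \<Rightarrow> complex) \<Rightarrow> complex ^ 'n \<Rightarrow> complex ^ 'n \<Rightarrow> complex" where
  "dir_deriv f v w = deriv (\<lambda>t. f (v + t *s w)) 0"

definition hessian ::
    "(complex ^ 'n \<Rightarrow> complex) \<Rightarrow> complex ^ 'n \<Rightarrow> complex ^ 'n \<Rightarrow> complex ^ 'n \<Rightarrow> complex" where
  "hessian f v w z = dir_deriv (\<lambda>x. dir_deriv f x z) v w"

text \<open>For a form \<open>f\<close> of degree at least 2 that is singular at \<open>p = [v]\<close>, Euler's relation puts \<open>v\<close>
  in the radical of the Hessian on \<open>V\<close>. In an affine chart of \<open>P(V)\<close> around \<open>p\<close> the quadratic part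
  of the local equation is, up to a factor, the form that the Hessian induces on \<open>V / p\<close>; the
  last condition of \<open>is_node\<close> says that it is nondegenerate, i.e. \<open>p\<close> is an ordinary double
  point. The conditions do not depend on the representative \<open>v\<close>.\<close>

definition is_singular ::
    "(complex ^ 'n) set \<Rightarrow> (complex ^ 'n \<Rightarrow> complex) \<Rightarrow> complex ^ 'n \<Rightarrow> bool" where
  "is_singular V f v \<longleftrightarrow> f v = 0 \<and> (\<forall>w\<in>V. dir_deriv f v w = 0)"

definition is_node ::
    "(complex ^ 'n) set \<Rightarrow> (complex ^ 'n \<Rightarrow> complex) \<Rightarrow> (complex ^ 'n) set \<Rightarrow> bool" where
  "is_node V f p \<longleftrightarrow>
     (\<exists>v\<in>V. v \<noteq> 0 \<and> p = vec.span {v} \<and> is_singular V f v \<and>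
        (\<forall>w\<in>V. (\<forall>z\<in>V. hessian f v w z = 0) \<longrightarrow> w \<in> p))"

definition nodes ::
    "(complex ^ 'n) set \<Rightarrow> (complex ^ 'n \<Rightarrow> complex) \<Rightarrow> (complex ^ 'n) set set" where
  "nodes V f = {p. is_node V f p}"

definition proj_equivalent ::
    "(complex ^ 'n) set \<Rightarrow> (complex ^ 'n \<Rightarrow> complex) \<Rightarrow>
     (complex ^ 'n) set \<Rightarrow> (complex ^ 'n \<Rightarrow> complex) \<Rightarrow> bool" where
  "proj_equivalent V f W g \<longleftrightarrow>
     (\<exists>M c. invertible M \<and> c \<noteq> 0 \<and> (*v) M ` V = W \<and> (\<forall>x\<in>V. f x = c * g (M *v x)))"

text \<open>Elementary symmetric polynomial of degree \<open>r\<close> in the coordinates indexed by \<open>S\<close>.\<close>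

definition esym :: "'n set \<Rightarrow> nat \<Rightarrow> complex ^ 'n \<Rightarrow> complex" where
  "esym S r x = (\<Sum>A | A \<subseteq> S \<and> card A = r. \<Prod>i\<in>A. x $ i)"

text \<open>The six coordinates are indexed by \<open>0, \<dots>, 5\<close>, the elements of the type \<open>6\<close>.\<close>

definition is_Burkhardt :: "(complex ^ 6) set \<Rightarrow> (complex ^ 6 \<Rightarrow> complex) \<Rightarrow> bool" where
  "is_Burkhardt V f \<longleftrightarrow> proj_equivalent V f {x. esym UNIV 1 x = 0} (esym UNIV 4)"

definition is_Steiner_hyperplane ::
    "(complex ^ 6) set \<Rightarrow> (complex ^ 6 \<Rightarrow> complex) \<Rightarrow> (complex ^ 6) set set \<Rightarrow> bool" where
  "is_Steiner_hyperplane V f H \<longleftrightarrow>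
     is_Burkhardt V f \<and> is_hyperplane V H \<and> card (H \<inter> nodes V f) = 18"

text \<open>Coordinates \<open>[a : u\<^sub>1 : \<dots> : u\<^sub>5]\<close>: \<open>a = x $ 0\<close> and \<open>u\<^sub>i = x $ i\<close> for \<open>i \<in> I5\<close>.\<close>

definition I5 :: "6 set" where
  "I5 = {1, 2, 3, 4, 5}"

definition L :: "complex \<Rightarrow> (complex ^ 6) set" where
  "L \<eta> = {x. (\<Sum>i\<in>I5. x $ i) = \<eta> * x $ 0}"

definition quartic :: "complex ^ 6 \<Rightarrow> complex" where
  "quartic x = (x $ 0) ^ 4 + (x $ 0)\<^sup>2 * esym I5 2 x + esym I5 4 x"

definition X :: "complex \<Rightarrow> (complex ^ 6) set set" where
  "X \<eta> = hypersurface (L \<eta>) quartic"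

definition F :: "complex \<Rightarrow> 6 \<Rightarrow> (complex ^ 6) set set" where
  "F \<eta> i = hypersurface (L \<eta>) (\<lambda>x. x $ 0 + x $ i)"

definition G :: "complex \<Rightarrow> 6 \<Rightarrow> (complex ^ 6) set set" where
  "G \<eta> i = hypersurface (L \<eta>) (\<lambda>x. x $ 0 - x $ i)"

definition Pi_plane :: "complex \<Rightarrow> 6 \<Rightarrow> 6 \<Rightarrow> (complex ^ 6) set set" where
  "Pi_plane \<eta> i j = F \<eta> i \<inter> G \<eta> j"

end

theory Submission
  imports Defs
begin

text \<open>On the hyperplane \<open>u\<^sub>i = -a\<close> the quartic becomes \<open>\<Prod>\<^bsub>j \<noteq> i\<^esub> (a - u\<^sub>j)\<close>, and on
  \<open>u\<^sub>i = a\<close> it becomes \<open>\<Prod>\<^bsub>j \<noteq> i\<^esub> (a + u\<^sub>j)\<close>. At a singular point with \<open>u\<^sub>i = -a\<close> therefore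
  some \<open>u\<^sub>j = a\<close>, and the derivatives in the directions \<open>e\<^sub>i - e\<^sub>k\<close> and \<open>e\<^sub>j - e\<^sub>k\<close>, which
  factor, force another coordinate \<open>-a\<close> and another \<open>a\<close>. For \<open>a \<noteq> 0\<close> this leaves twelve
  points of type \<open>R\<close>, for \<open>a = 0\<close> six points of type \<open>T\<close>. The linear map
  \<open>y\<^sub>i = u\<^sub>i - (\<eta> / 3) a\<close>, \<open>y\<^sub>0 = (2 \<eta> / 3) a\<close> carries the quartic to
  \<open>\<sigma>\<^sub>1 = \<sigma>\<^sub>4 = 0\<close>; up to scale it is the \<open>S\<^sub>5\<close>-equivariant map that sends the nodes
  \<open>E\<^sub>c\<close> to \<open>e\<^sub>c - e\<^sub>0\<close>.\<close>

section \<open>Recursion for elementary symmetric polynomials\<close>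

lemma esym_0: "finite S \<Longrightarrow> esym S 0 x = 1"
proof -
  assume "finite S"
  then have "{A. A \<subseteq> S \<and> card A = 0} = {{}}"
    using finite_subset by fastforce
  then show ?thesis by (simp add: esym_def)
qed

lemma esym_empty: "esym {} (Suc r) x = 0"
  by (simp add: esym_def)

text \<open>Split the subsets of size \<open>Suc r\<close> by whether they contain \<open>i\<close>.
  Applied repeatedly, this recursion expands \<open>esym\<close> over any explicitly listed index
  set.\<close>

lemma esym_insert:
  assumes "finite S" "i \<notin> S"
  shows "esym (insert i S) (Suc r) x = esym S (Suc r) x + x $ i * esym S r x"
proof -
  let ?P = "\<lambda>k. {A. A \<subseteq> S \<and> card A = k}"
  have fin: "finite (?P k)" for k
    using assms(1) by (rule finite_subset[rotated, OF finite_Pow_iff[THEN iffD2]]) auto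
  have fin': "finite A" if "A \<in> ?P k" for A k
    using that assms(1) finite_subset by auto
  have "{A. A \<subseteq> insert i S \<and> card A = Suc r} = ?P (Suc r) \<union> insert i ` ?P r" (is "?l = ?r")
  proof
    show "?l \<subseteq> ?r"
    proof
      fix A assume A: "A \<in> ?l"
      then have f: "finite A" using assms(1) finite_subset by auto
      show "A \<in> ?r"
      proof (cases "i \<in> A")
        case True
        then have "A = insert i (A - {i})" "A - {i} \<in> ?P r"
          using A f by (auto simp: card_Diff_singleton)
        then show ?thesis by blast
      next
        case False
        then show ?thesis using A by auto
      qed
    qed
    show "?r \<subseteq> ?l"
      using assms fin' by (auto simp: card_insert_if)
  qed
  moreover have "?P (Suc r) \<inter> insert i ` ?P r = {}"
    using assms(2) by auto
  moreover have "inj_on (insert i) (?P r)"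
    using assms(2) by (auto simp: inj_on_def)
  moreover have "(\<Sum>A\<in>?P r. \<Prod>j\<in>insert i A. x $ j) = x $ i * esym S r x"
    unfolding esym_def sum_distrib_left
  proof (rule sum.cong[OF refl])
    fix A assume "A \<in> ?P r"
    then show "(\<Prod>j\<in>insert i A. x $ j) = x $ i * (\<Prod>j\<in>A. x $ j)"
      using assms(2) fin' by (subst prod.insert) auto
  qed
  ultimately show ?thesis
    unfolding esym_def using fin by (simp add: sum.union_disjoint sum.reindex)
qed

section \<open>The six indices and their labellings\<close>

lemma UNIV_6: "(UNIV :: 6 set) = {0, 1, 2, 3, 4, 5}"
proof -
  have "card {0, 1, 2, 3, 4, 5 :: 6} = card (UNIV :: 6 set)" by simp
  then show ?thesis by (metis card_subset_eq finite subset_UNIV)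
qed

lemma forall_6: "(\<forall>i::6. P i) \<longleftrightarrow> P 0 \<and> (\<forall>i\<in>I5. P i)"
proof -
  have "(\<forall>i::6. P i) \<longleftrightarrow> (\<forall>i\<in>UNIV. P i)" by simp
  then show ?thesis unfolding UNIV_6 I5_def by simp
qed

lemma card_I5: "card I5 = 5" and zero_notin_I5: "0 \<notin> I5" and finite_I5: "finite I5"
  by (simp_all add: I5_def)

lemma UNIV_eq_insert_I5: "UNIV = insert 0 I5"
  unfolding UNIV_6 I5_def by (rule refl)

lemma in_I5_iff: "r \<in> I5 \<longleftrightarrow> r \<noteq> 0"
  using UNIV_eq_insert_I5 zero_notin_I5 by blast

text \<open>Enumerating the indices in an arbitrary order replaces the action of the symmetric group
  \<open>S\<^sub>5\<close>: explicit formulas are proved once, for variable indices.\<close>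

definition labelling :: "6 \<Rightarrow> 6 \<Rightarrow> 6 \<Rightarrow> 6 \<Rightarrow> 6 \<Rightarrow> bool" where
  "labelling i j k l m \<longleftrightarrow> I5 = {i, j, k, l, m} \<and> distinct [i, j, k, l, m]"

lemma labelling_neq:
  assumes "labelling i j k l m"
  shows "i \<noteq> j" "i \<noteq> k" "i \<noteq> l" "i \<noteq> m" "j \<noteq> k" "j \<noteq> l" "j \<noteq> m" "k \<noteq> l" "k \<noteq> m" "l \<noteq> m"
    "j \<noteq> i" "k \<noteq> i" "l \<noteq> i" "m \<noteq> i" "k \<noteq> j" "l \<noteq> j" "m \<noteq> j" "l \<noteq> k" "m \<noteq> k" "m \<noteq> l"
    "i \<noteq> 0" "j \<noteq> 0" "k \<noteq> 0" "l \<noteq> 0" "m \<noteq> 0"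
    "0 \<noteq> i" "0 \<noteq> j" "0 \<noteq> k" "0 \<noteq> l" "0 \<noteq> m"
  using assms zero_notin_I5 by (auto simp: labelling_def)

text \<open>The derivative formulas below want the two indices of a direction \<open>T\<close> in
  the first two places; these rearrangements supply every pair that the proofs differentiate
  along.\<close>

lemma labelling_perms:
  assumes "labelling i j k l m"
  shows "labelling k i j l m" "labelling l i j k m" "labelling m i j k l" "labelling l m i j k"
    "labelling i l j k m" "labelling i k j l m" "labelling j k i l m"
proof -
  have sets: "{k, i, j, l, m} = {i, j, k, l, m}" "{l, i, j, k, m} = {i, j, k, l, m}"
    "{m, i, j, k, l} = {i, j, k, l, m}" "{l, m, i, j, k} = {i, j, k, l, m}"
    "{i, l, j, k, m} = {i, j, k, l, m}" "{i, k, j, l, m} = {i, j, k, l, m}"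
    "{j, k, i, l, m} = {i, j, k, l, m}"
    by blast+
  show "labelling k i j l m" "labelling l i j k m" "labelling m i j k l" "labelling l m i j k"
    "labelling i l j k m" "labelling i k j l m" "labelling j k i l m"
    using assms labelling_neq[OF assms] by (simp_all only: labelling_def sets) simp_all
qed

lemma labelling_exists2:
  assumes "i \<in> I5" "j \<in> I5" "i \<noteq> j"
  obtains k l m where "labelling i j k l m"
proof -
  have "card (I5 - {i, j}) = 3"
    using assms by (subst card_Diff_subset) (auto simp: card_I5)
  then obtain k l m where *: "I5 - {i, j} = {k, l, m}" "k \<noteq> l" "l \<noteq> m" "k \<noteq> m"
    unfolding card_3_iff by blast
  then have "I5 = {i, j} \<union> {k, l, m}" using assms by auto
  moreover have "{i, j} \<inter> {k, l, m} = {}" using *(1) by blast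
  ultimately have "labelling i j k l m"
    using * assms(3) by (auto simp: labelling_def)
  then show thesis by (rule that)
qed

lemma labelling_exists4:
  assumes "i \<in> I5" "j \<in> I5" "k \<in> I5" "l \<in> I5" "distinct [i, j, k, l]"
  obtains m where "labelling i j k l m"
proof -
  have "card (I5 - {i, j, k, l}) = 1"
    using assms by (subst card_Diff_subset) (auto simp: card_I5)
  then obtain m where *: "I5 - {i, j, k, l} = {m}"
    by (auto simp: card_1_singleton_iff)
  then have "I5 = {i, j, k, l} \<union> {m}" using assms by auto
  moreover have "m \<notin> {i, j, k, l}" using * by blast
  ultimately have "labelling i j k l m"
    using assms(5) by (auto simp: labelling_def)
  then show thesis by (rule that)
qed

lemma labelling_exists3:
  assumes "i \<in> I5" "j \<in> I5" "k \<in> I5" "distinct [i, j, k]"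
  obtains l m where "labelling i j k l m"
proof -
  from assms obtain a b c where l: "labelling i j a b c"
    using labelling_exists2[of i j] by auto
  then have "k \<in> {a, b, c}" using assms by (auto simp: labelling_def)
  then have "labelling i j k b c \<or> labelling i j k a c \<or> labelling i j k a b"
    using l by (auto simp: labelling_def)
  then show thesis using that by blast
qed

section \<open>The quartic and its derivatives in labelled coordinates\<close>

context
  fixes i j k l m assumes lab: "labelling i j k l m"
begin

lemma I5_labelling: "I5 = {i, j, k, l, m}"
  using lab by (simp add: labelling_def)

lemma sum_labelling: "(\<Sum>p\<in>I5. f p) = f i + f j + f k + f l + (f m :: complex)"
  unfolding I5_labelling by (simp add: labelling_neq[OF lab] add.assoc)

lemma vec_eq_labelling:
  "x = y \<longleftrightarrow> x $ 0 = y $ 0 \<and> x $ i = y $ i \<and> x $ j = y $ j \<and> x $ k = y $ k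
     \<and> x $ l = y $ l \<and> x $ m = (y :: complex ^ 6) $ m"
  unfolding vec_eq_iff forall_6 I5_labelling by simp

lemma quartic_labelling:
  "quartic x = x $ 0 ^ 4 + (x $ 0)\<^sup>2 *
     (x $ i * x $ j + x $ i * x $ k + x $ i * x $ l + x $ i * x $ m + x $ j * x $ k
      + x $ j * x $ l + x $ j * x $ m + x $ k * x $ l + x $ k * x $ m + x $ l * x $ m)
     + x $ i * x $ j * x $ k * x $ l + x $ i * x $ j * x $ k * x $ m + x $ i * x $ j * x $ l * x $ m
     + x $ i * x $ k * x $ l * x $ m + x $ j * x $ k * x $ l * x $ m"
  unfolding quartic_def I5_labelling
  by (simp add: labelling_neq[OF lab] eval_nat_numeral esym_insert esym_0 esym_empty algebra_simps)

lemma dir_deriv_quartic: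
  "dir_deriv quartic v w =
     w $ 0 * (4 * v $ 0 ^ 3 + 2 * v $ 0 *
       (v $ i * v $ j + v $ i * v $ k + v $ i * v $ l + v $ i * v $ m + v $ j * v $ k
        + v $ j * v $ l + v $ j * v $ m + v $ k * v $ l + v $ k * v $ m + v $ l * v $ m))
   + w $ i * ((v $ 0)\<^sup>2 * (v $ j + v $ k + v $ l + v $ m)
       + v $ j * v $ k * v $ l + v $ j * v $ k * v $ m + v $ j * v $ l * v $ m + v $ k * v $ l * v $ m)
   + w $ j * ((v $ 0)\<^sup>2 * (v $ i + v $ k + v $ l + v $ m)
       + v $ i * v $ k * v $ l + v $ i * v $ k * v $ m + v $ i * v $ l * v $ m + v $ k * v $ l * v $ m)
   + w $ k * ((v $ 0)\<^sup>2 * (v $ i + v $ j + v $ l + v $ m)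
       + v $ i * v $ j * v $ l + v $ i * v $ j * v $ m + v $ i * v $ l * v $ m + v $ j * v $ l * v $ m)
   + w $ l * ((v $ 0)\<^sup>2 * (v $ i + v $ j + v $ k + v $ m)
       + v $ i * v $ j * v $ k + v $ i * v $ j * v $ m + v $ i * v $ k * v $ m + v $ j * v $ k * v $ m)
   + w $ m * ((v $ 0)\<^sup>2 * (v $ i + v $ j + v $ k + v $ l)
       + v $ i * v $ j * v $ k + v $ i * v $ j * v $ l + v $ i * v $ k * v $ l + v $ j * v $ k * v $ l)"
  unfolding dir_deriv_def quartic_labelling
  by (rule DERIV_imp_deriv)
     (auto intro!: derivative_eq_intros simp: power2_eq_square power3_eq_cube algebra_simps)

end

section \<open>Derivatives along differences of basis vectors\<close>

text \<open>For distinct \<open>p\<close>, \<open>q\<close> in \<open>I5\<close> this vector plays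
  two roles: it represents the node \<open>T_C\<close> with C = {p, q}, and it is a direction inside
  \<open>L \<eta>\<close> with a = 0 along which the quartic is differentiated.\<close>

definition T :: "6 \<Rightarrow> 6 \<Rightarrow> complex ^ 6" where
  "T p q = axis p 1 - axis q 1"

lemma T_nth: "T p q $ r = (if r = p then 1 else 0) - (if r = q then 1 else 0)"
  by (auto simp: T_def axis_def)

lemma T_nonzero:
  assumes "p \<noteq> q"
  shows "T p q \<noteq> 0"
proof -
  have "T p q $ p \<noteq> 0" using assms by (simp add: T_nth)
  then show ?thesis by auto
qed

lemma T_in_L: "p \<in> I5 \<Longrightarrow> q \<in> I5 \<Longrightarrow> T p q \<in> L \<eta>"
  using zero_notin_I5 finite_I5 by (auto simp: L_def T_nth sum_subtractf)

text \<open>The quartic is symmetric and multilinear in u_i and u_j, hence of the form u_i u_j P +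
  (u_i + u_j) Q + S. Its derivative along e_i - e_j is (u_j - u_i) P, and P = a^2 + e_2(u_k, u_l,
  u_m).\<close>

lemma dir_deriv_quartic_T:
  assumes "labelling i j k l m"
  shows "dir_deriv quartic v (T i j)
    = - ((v $ i - v $ j) * ((v $ 0)\<^sup>2 + v $ k * v $ l + v $ k * v $ m + v $ l * v $ m))"
  unfolding dir_deriv_quartic[OF assms]
  by (simp add: T_nth labelling_neq[OF assms] algebra_simps)

lemma hessian_quartic_T:
  assumes "labelling i j k l m"
  shows "hessian quartic v w (T i j)
    = - ((w $ i - w $ j) * ((v $ 0)\<^sup>2 + v $ k * v $ l + v $ k * v $ m + v $ l * v $ m)
       + (v $ i - v $ j) * (2 * v $ 0 * w $ 0 + w $ k * (v $ l + v $ m)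
           + w $ l * (v $ k + v $ m) + w $ m * (v $ k + v $ l)))"
  unfolding hessian_def dir_deriv_quartic_T[OF assms]
  unfolding dir_deriv_def
  by (rule DERIV_imp_deriv)
     (auto intro!: derivative_eq_intros simp: power2_eq_square algebra_simps)


text \<open>The direction has a = 1 and lies in \<open>L \<eta>\<close>, so it complements the
  directions \<open>T\<close>. At \<open>T i j\<close> only the term a^2 e_2 contributes, and e_2 =
  -1 there.\<close>

lemma hessian_quartic_T_0:
  assumes "labelling i j k l m"
  shows "hessian quartic (T i j) w (axis 0 1 + \<eta> *s axis i 1) = - 2 * w $ 0"
proof -
  have eq: "dir_deriv quartic x (axis 0 1 + \<eta> *s axis i 1) =
     4 * x $ 0 ^ 3 + 2 * x $ 0 *
       (x $ i * x $ j + x $ i * x $ k + x $ i * x $ l + x $ i * x $ m + x $ j * x $ k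
        + x $ j * x $ l + x $ j * x $ m + x $ k * x $ l + x $ k * x $ m + x $ l * x $ m)
     + \<eta> * ((x $ 0)\<^sup>2 * (x $ j + x $ k + x $ l + x $ m)
       + x $ j * x $ k * x $ l + x $ j * x $ k * x $ m + x $ j * x $ l * x $ m + x $ k * x $ l * x $ m)"
    for x
    unfolding dir_deriv_quartic[OF assms] by (simp add: axis_def labelling_neq[OF assms])
  show ?thesis
    unfolding hessian_def eq unfolding dir_deriv_def
    by (rule DERIV_imp_deriv)
       (auto intro!: derivative_eq_intros simp: T_nth labelling_neq[OF assms])
qed

text \<open>The node \<open>R\<^bsub>A,B;c\<^esub>\<close> for \<open>A = {i, k}\<close>, in a form that treats the
  hyperplanes \<open>F\<^sub>i\<close> (\<open>s = 1\<close>) and \<open>G\<^sub>i\<close> (\<open>s = -1\<close>) at once; for \<open>s = -1\<close> it is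
  \<open>R\<^bsub>B,A;c\<^esub>\<close>, rescaled to \<open>a = -1\<close>.\<close>

definition R :: "complex \<Rightarrow> complex \<Rightarrow> 6 \<Rightarrow> 6 \<Rightarrow> 6 \<Rightarrow> complex ^ 6" where
  "R \<eta> s i k c = (\<chi> r. if r = 0 then s else if r = i \<or> r = k then -1 else if r = c then s * \<eta> else 1)"

lemma R_nth: "R \<eta> s i k c $ r =
    (if r = 0 then s else if r = i \<or> r = k then -1 else if r = c then s * \<eta> else 1)"
  by (simp add: R_def)

lemma R_nonzero:
  assumes "s\<^sup>2 = 1"
  shows "R \<eta> s i k c \<noteq> 0"
proof -
  have "R \<eta> s i k c $ 0 \<noteq> 0" using assms by (auto simp: R_nth)
  then show ?thesis by auto
qed

lemma R_in_L:
  assumes "i \<in> I5" "k \<in> I5" "c \<in> I5" "distinct [i, k, c]"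
  shows "R \<eta> s i k c \<in> L \<eta>"
proof -
  obtain l m where lab: "labelling i k c l m"
    using labelling_exists3[OF assms] .
  show ?thesis
    unfolding L_def by (simp add: sum_labelling[OF lab] R_nth labelling_neq[OF lab])
qed

section \<open>The points T and R are nodes\<close>

text \<open>All six partial derivatives vanish at the point, so it is singular relative to every
  \<open>V\<close>; the same happens for \<open>R\<close>.\<close>

lemma is_singular_T:
  assumes "p \<in> I5" "q \<in> I5" "p \<noteq> q"
  shows "is_singular V quartic (T p q)"
proof -
  obtain k l m where lab: "labelling p q k l m"
    using labelling_exists2[OF assms] .
  show ?thesis
    unfolding is_singular_def quartic_labelling[OF lab] dir_deriv_quartic[OF lab]
    by (simp add: T_nth labelling_neq[OF lab])
qed

lemma is_singular_R:
  assumes "i \<in> I5" "k \<in> I5" "c \<in> I5" "distinct [i, k, c]" "s\<^sup>2 = 1"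
  shows "is_singular V quartic (R \<eta> s i k c)"
proof -
  obtain l m where lab: "labelling i k c l m"
    using labelling_exists3[OF assms(1-4)] .
  have s: "s ^ 3 = s" "s ^ 4 = 1"
    using assms(5) by (simp_all add: eval_nat_numeral)
  show ?thesis
    unfolding is_singular_def quartic_labelling[OF lab] dir_deriv_quartic[OF lab]
    by (simp add: R_nth labelling_neq[OF lab] s assms(5) algebra_simps)
qed

lemma in_span_singleton: "w \<in> vec.span {v} \<longleftrightarrow> (\<exists>c. w = c *s (v :: complex ^ 'n))"
  by (auto simp: vec.span_singleton)

text \<open>Testing a radical vector against three directions \<open>T\<close> makes the coordinates
  off {p, q} sum to zero in pairs, hence vanish. A direction with a = 1 then kills
  \<open>w $ 0\<close>, and the equation of \<open>L \<eta>\<close> leaves only multiples of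
  \<open>T p q\<close>.\<close>

lemma node_T:
  assumes "p \<in> I5" "q \<in> I5" "p \<noteq> q"
  shows "vec.span {T p q} \<in> nodes (L \<eta>) quartic"
proof -
  obtain k l m where lab: "labelling p q k l m"
    using labelling_exists2[OF assms] .
  note neq = labelling_neq[OF lab]
  have I: "k \<in> I5" "l \<in> I5" "m \<in> I5" using I5_labelling[OF lab] by auto
  have "T p q \<noteq> 0" using assms(3) by (rule T_nonzero)
  moreover have "w \<in> vec.span {T p q}"
    if w: "w \<in> L \<eta>" and rad: "\<forall>z\<in>L \<eta>. hessian quartic (T p q) w z = 0" for w
  proof -
    have labs: "labelling k p q l m" "labelling l p q k m" "labelling m p q k l"
      by (rule labelling_perms[OF lab])+
    have T: "T p q $ 0 = 0" "T p q $ p = 1" "T p q $ q = -1"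
      "T p q $ k = 0" "T p q $ l = 0" "T p q $ m = 0"
      by (simp_all add: T_nth neq)
    note r = rad[rule_format, OF T_in_L[OF _ assms(1)]]
    \<comment> \<open>Only the coordinates \<open>p\<close> and \<open>q\<close> of the point are
      nonzero, so the first summand of the Hessian formula vanishes and two terms of the second
      survive.\<close>
    have "- (w $ l + w $ m) = hessian quartic (T p q) w (T k p)"
      unfolding hessian_quartic_T[OF labs(1)] T by simp
    then have 1: "w $ l + w $ m = 0" using r[OF I(1)] by (metis neg_equal_0_iff_equal)
    have "- (w $ k + w $ m) = hessian quartic (T p q) w (T l p)"
      unfolding hessian_quartic_T[OF labs(2)] T by simp
    then have 2: "w $ k + w $ m = 0" using r[OF I(2)] by (metis neg_equal_0_iff_equal)
    have "- (w $ k + w $ l) = hessian quartic (T p q) w (T m p)"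
      unfolding hessian_quartic_T[OF labs(3)] T by simp
    then have 3: "w $ k + w $ l = 0" using r[OF I(3)] by (metis neg_equal_0_iff_equal)
    have "2 * w $ k = (w $ k + w $ m) + (w $ k + w $ l) - (w $ l + w $ m)" by algebra
    then have k: "w $ k = 0" unfolding 1 2 3 by simp
    then have klm: "w $ k = 0" "w $ l = 0" "w $ m = 0" using 2 3 by simp_all
    have "axis 0 1 + \<eta> *s axis p 1 \<in> L \<eta>"
      using zero_notin_I5 by (simp add: L_def sum_labelling[OF lab] axis_def neq)
    then have "w $ 0 = 0"
      using rad hessian_quartic_T_0[OF lab] by fastforce
    moreover from this have "w $ p + w $ q = 0"
      using w by (simp add: L_def sum_labelling[OF lab] klm)
    ultimately have "w = w $ p *s T p q"
      unfolding vec_eq_labelling[OF lab]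
      by (simp add: T_nth neq klm add_eq_0_iff)
    then show ?thesis by (auto simp: in_span_singleton)
  qed
  ultimately show ?thesis
    unfolding nodes_def is_node_def mem_Collect_eq
    using T_in_L[OF assms(1,2)] is_singular_T[OF assms] by blast
qed

text \<open>Four test directions give four linear conditions on a radical vector, each solvable
  because s \<eta> is neither 1 nor -1. The equation of \<open>L \<eta>\<close> fixes the remaining
  coordinate \<open>w $ c\<close>.\<close>

lemma node_R:
  assumes "i \<in> I5" "k \<in> I5" "c \<in> I5" "distinct [i, k, c]" "s\<^sup>2 = 1" "\<eta>\<^sup>2 = -3"
  shows "vec.span {R \<eta> s i k c} \<in> nodes (L \<eta>) quartic"
proof -
  obtain l m where lab: "labelling i k c l m"
    using labelling_exists3[OF assms(1-4)] .
  note neq = labelling_neq[OF lab]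
  have I: "l \<in> I5" "m \<in> I5" using I5_labelling[OF lab] by auto
  have s\<eta>: "(s * \<eta>)\<^sup>2 = -3" using assms(5,6) by (simp add: power_mult_distrib)
  then have ne: "s * \<eta> \<noteq> 1" "s * \<eta> \<noteq> -1" by auto
  have "R \<eta> s i k c \<noteq> 0" using assms(5) by (rule R_nonzero)
  moreover have "w \<in> vec.span {R \<eta> s i k c}"
    if w: "w \<in> L \<eta>" and rad: "\<forall>z\<in>L \<eta>. hessian quartic (R \<eta> s i k c) w z = 0" for w
  proof -
    have labs: "labelling i k c l m" "labelling l m i k c" "labelling i l k c m" "labelling i c k l m"
      by (rule lab labelling_perms[OF lab])+
    note r = rad[rule_format, OF T_in_L]
    have R: "R \<eta> s i k c $ 0 = s" "R \<eta> s i k c $ i = -1" "R \<eta> s i k c $ k = -1"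
      "R \<eta> s i k c $ c = s * \<eta>" "R \<eta> s i k c $ l = 1" "R \<eta> s i k c $ m = 1"
      by (simp_all add: R_nth neq)
    have "(w $ i - w $ k) * (1 + s * \<eta>) = 0"
      using r[OF assms(1,2)] unfolding hessian_quartic_T[OF labs(1)] R assms(5) by algebra
    then have ik: "w $ i = w $ k" using ne by (simp add: add_eq_0_iff)
    have "(w $ l - w $ m) * (1 - s * \<eta>) = 0"
      using r[OF I] unfolding hessian_quartic_T[OF labs(2)] R assms(5) by algebra
    then have lm: "w $ l = w $ m" using ne by simp
    \<comment> \<open>Here a^2 + e_2(-1, 1, 1) = 0, so \<open>w $ c\<close> drops out.\<close>
    have "(s * \<eta> + 1) * (s * w $ 0 + w $ k) = 0"
      using r[OF assms(1,3)] unfolding hessian_quartic_T[OF labs(4)] R assms(5) lm by algebra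
    then have "s * w $ 0 + w $ k = 0" using ne(2) by (metis add_eq_0_iff2 mult_eq_0_iff)
    then have k: "w $ k = - (s * w $ 0)" by (simp add: add_eq_0_iff)
    \<comment> \<open>Along \<open>T i l\<close> the factor a^2 + e_2(-1, s \<eta>, 1) is zero, and
      the coefficient of \<open>w $ c\<close> is -1 + 1 = 0.\<close>
    have "2 * s * w $ 0 + w $ k * (s * \<eta> + 1) + w $ m * (s * \<eta> - 1) = 0"
      using r[OF assms(1) I(1)] unfolding hessian_quartic_T[OF labs(3)] R assms(5) by algebra
    then have "(w $ m - s * w $ 0) * (s * \<eta> - 1) = 0"
      unfolding k by algebra
    then have m: "w $ m = s * w $ 0" using ne by simp
    have "w $ c = \<eta> * w $ 0"
      using w by (simp add: L_def sum_labelling[OF lab] ik lm k m)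
    then have "w = (s * w $ 0) *s R \<eta> s i k c"
      unfolding vec_eq_labelling[OF lab] using assms(5)
      by (simp add: R_nth neq ik lm k m power2_eq_square mult_ac)
    then show ?thesis by (auto simp: in_span_singleton)
  qed
  ultimately show ?thesis
    unfolding nodes_def is_node_def mem_Collect_eq
    using R_in_L[OF assms(1-4)] is_singular_R[OF assms(1-5)] by blast
qed

section \<open>Singular points on a hyperplane F or G\<close>

text \<open>Put b = s a, so a^2 = b^2. Substituting u_i = -b turns a^4 + a^2 e_2 + e_4 into b^4 -
  b^3 e_1 + b^2 e_2 - b e_3 + e_4 in the other four coordinates, which is the expansion of the
  product.\<close>

lemma quartic_on_hyperplane:
  assumes "i \<in> I5" "s\<^sup>2 = 1" "s * x $ 0 + x $ i = 0"
  shows "quartic x = (\<Prod>j\<in>I5 - {i}. s * x $ 0 - x $ j)"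
proof -
  have "I5 - {i} \<noteq> {}"
    by (auto simp: I5_def)
  then obtain j k l m where lab: "labelling i j k l m"
    using labelling_exists2[OF assms(1)] by (metis Diff_iff ex_in_conv insert_iff)
  define b where "b = s * x $ 0"
  have 1: "I5 - {i} = {j, k, l, m}"
    unfolding I5_labelling[OF lab] using labelling_neq[OF lab] by auto
  have 2: "x $ i = - b" using assms(3) by (simp add: b_def add_eq_0_iff2)
  have 3: "(x $ 0)\<^sup>2 = b\<^sup>2" using assms(2) by (simp add: b_def power_mult_distrib)
  then have 4: "x $ 0 ^ 4 = b ^ 4" by (metis mult_2 numeral_Bit0 power2_eq_square power_add)
  have "(\<Prod>j\<in>I5 - {i}. b - x $ j) = (b - x $ j) * (b - x $ k) * (b - x $ l) * (b - x $ m)"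
    unfolding 1 by (simp add: labelling_neq[OF lab] mult.assoc)
  also have "\<dots> = quartic x"
    unfolding quartic_labelling[OF lab] 2 3 4 by algebra
  finally show ?thesis unfolding b_def by (rule sym)
qed

lemma singular_on_hyperplane:
  assumes i: "i \<in> I5" and s: "s\<^sup>2 = 1" and h: "s * v $ 0 + v $ i = 0"
    and v: "v \<in> L \<eta>" and sing: "is_singular (L \<eta>) quartic v"
  shows "(\<exists>k\<in>I5 - {i}. \<exists>c\<in>I5 - {i}. k \<noteq> c \<and> v = (s * v $ 0) *s R \<eta> s i k c)
    \<or> (\<exists>p\<in>I5 - {i}. \<exists>q\<in>I5 - {i}. p \<noteq> q \<and> v = v $ p *s T p q)"
proof -
  define b where "b = s * v $ 0"
  have b2: "(v $ 0)\<^sup>2 = b\<^sup>2" using s by (simp add: b_def power_mult_distrib)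
  have v0: "v $ 0 = s * b" using s by (simp add: b_def power2_eq_square mult.assoc[symmetric])
  have vi: "v $ i = - b" using h by (simp add: b_def add_eq_0_iff2)
  have "(\<Prod>j\<in>I5 - {i}. b - v $ j) = 0"
    using sing quartic_on_hyperplane[OF i s h] by (simp add: is_singular_def b_def)
  then obtain j where j: "j \<in> I5" "j \<noteq> i" and vj: "v $ j = b"
    using finite_I5 by auto
  then obtain k l m where lab: "labelling i j k l m"
    using labelling_exists2[OF i j(1)] by metis
  note neq = labelling_neq[OF lab]
  have K: "I5 - {i, j} = {k, l, m}"
    unfolding I5_labelling[OF lab] using neq by auto
  have d: "dir_deriv quartic v (T p q) = 0" if "p \<in> I5" "q \<in> I5" for p q
    using sing T_in_L[OF that] by (simp add: is_singular_def)
  have I: "k \<in> I5" "l \<in> I5" "m \<in> I5" using K by auto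
  have labs: "labelling i k j l m" "labelling j k i l m"
    by (rule labelling_perms[OF lab])+
  \<comment> \<open>As v_i = -b and v_j = b, the quadratic factor of the derivative along
    \<open>T i k\<close> is (b + v_l)(b + v_m). Its vanishing yields a second coordinate -b.\<close>
  have "(b + v $ k) * (b + v $ l) * (b + v $ m) = dir_deriv quartic v (T i k)"
    unfolding dir_deriv_quartic_T[OF labs(1)] vi vj b2 by algebra
  also have "\<dots> = 0" by (rule d[OF i I(1)])
  finally have "(\<Prod>r\<in>I5 - {i, j}. b + v $ r) = 0"
    unfolding K by (simp add: neq mult.assoc)
  then obtain k' where k': "k' \<in> I5 - {i, j}" "v $ k' = - b"
    using finite_I5 by (auto simp: add_eq_0_iff)
  \<comment> \<open>The mirror image: removing \<open>j\<close> and \<open>k\<close> leaves v_i = -b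
    in the quadratic factor, which becomes (b - v_l)(b - v_m).\<close>
  have "(b - v $ k) * (b - v $ l) * (b - v $ m) = - dir_deriv quartic v (T j k)"
    unfolding dir_deriv_quartic_T[OF labs(2)] vi vj b2 by algebra
  also have "\<dots> = 0" by (simp add: d[OF j(1) I(1)])
  finally have "(\<Prod>r\<in>I5 - {i, j}. b - v $ r) = 0"
    unfolding K by (simp add: neq mult.assoc)
  then obtain l' where l': "l' \<in> I5 - {i, j}" "v $ l' = b"
    using finite_I5 by auto
  show ?thesis
  proof (cases "b = 0")
    case True
    \<comment> \<open>For b = 0 the indices \<open>k'\<close> and \<open>l'\<close> may coincide, so
      only \<open>k'\<close> is used. Three coordinates u vanish, and the other two are opposite by
      the equation of \<open>L \<eta>\<close>.\<close>
    obtain p q where lab': "labelling i j k' p q"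
      using labelling_exists3[OF i j(1), of k'] k' j(2) by auto
    note neq' = labelling_neq[OF lab']
    have pq: "p \<in> I5 - {i}" "q \<in> I5 - {i}" using I5_labelling[OF lab'] neq' by auto
    have "v $ p + v $ q = 0"
      using v by (simp add: L_def sum_labelling[OF lab'] vi vj k' v0 True)
    then have "v = v $ p *s T p q"
      unfolding vec_eq_labelling[OF lab']
      by (simp add: T_nth neq' vi vj k' v0 True add_eq_0_iff)
    then show ?thesis using pq neq'(10) by blast
  next
    case False
    \<comment> \<open>The values -b and b differ, so four coordinates u are now known and the
      equation of \<open>L \<eta>\<close> determines the fifth.\<close>
    then have "k' \<noteq> l'" using k' l' by auto
    then obtain c where lab': "labelling i j k' l' c"
      using labelling_exists4[OF i j(1), of k' l'] k' l' j(2) by auto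
    note neq' = labelling_neq[OF lab']
    have c: "c \<in> I5 - {i}" using I5_labelling[OF lab'] neq' by auto
    have "v $ c = \<eta> * s * b"
      using v by (simp add: L_def sum_labelling[OF lab'] vi vj k' l' v0 mult_ac)
    then have "v = b *s R \<eta> s i k' c"
      unfolding vec_eq_labelling[OF lab']
      by (simp add: R_nth neq' vi vj k' l' v0 mult_ac)
    then show ?thesis using k' c neq'(9) unfolding b_def by blast
  qed
qed

section \<open>The hyperplanes as sets of projective points, and their sections\<close>

text \<open>The sign \<open>s\<close> merges the two families: 1 gives \<open>F\<close>, and -1
  gives \<open>G\<close> with its equation negated.\<close>

definition hyp :: "complex \<Rightarrow> complex \<Rightarrow> 6 \<Rightarrow> (complex ^ 6) set set" where
  "hyp \<eta> s i = hypersurface (L \<eta>) (\<lambda>x. s * x $ 0 + x $ i)"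

lemma F_eq_hyp: "F \<eta> i = hyp \<eta> 1 i"
  by (simp add: F_def hyp_def)

lemma G_eq_hyp: "G \<eta> i = hyp \<eta> (-1) i"
  by (auto simp: G_def hyp_def hypersurface_def)

lemma span_singleton_in_hyp:
  assumes "v \<in> L \<eta>" "v \<noteq> 0"
  shows "vec.span {v} \<in> hyp \<eta> s i \<longleftrightarrow> s * v $ 0 + v $ i = 0"
proof -
  have "v \<in> vec.span {v}" by (simp add: vec.span_base)
  moreover have "s * x $ 0 + x $ i = 0" if "x \<in> vec.span {v}" "s * v $ 0 + v $ i = 0" for x
  proof -
    from that obtain c where "x = c *s v" by (auto simp: in_span_singleton)
    then have "s * x $ 0 + x $ i = c * (s * v $ 0 + v $ i)" by (simp add: algebra_simps)
    then show ?thesis using that by simp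
  qed
  ultimately show ?thesis
    using assms unfolding hyp_def hypersurface_def proj_space_def by blast
qed

lemma hypE:
  assumes "p \<in> hyp \<eta> s i"
  obtains v where "v \<in> L \<eta>" "v \<noteq> 0" "p = vec.span {v}" "s * v $ 0 + v $ i = 0"
proof -
  from assms obtain v where v: "v \<in> L \<eta>" "v \<noteq> 0" "p = vec.span {v}"
    by (auto simp: hyp_def hypersurface_def proj_space_def)
  moreover from this assms have "s * v $ 0 + v $ i = 0"
    using span_singleton_in_hyp by blast
  ultimately show thesis by (rule that)
qed

text \<open>The linear factors of the restricted quartic are, up to sign, the equations of the
  hyperplanes with opposite sign \<open>- s\<close>.\<close>

lemma hyp_Int_X:
  assumes "i \<in> I5" "s\<^sup>2 = 1"
  shows "hyp \<eta> s i \<inter> X \<eta> = (\<Union>j\<in>I5 - {i}. hyp \<eta> s i \<inter> hyp \<eta> (- s) j)"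
proof
  show "hyp \<eta> s i \<inter> X \<eta> \<subseteq> (\<Union>j\<in>I5 - {i}. hyp \<eta> s i \<inter> hyp \<eta> (- s) j)"
  proof
    fix p assume p: "p \<in> hyp \<eta> s i \<inter> X \<eta>"
    then obtain v where v: "v \<in> L \<eta>" "v \<noteq> 0" "p = vec.span {v}" "s * v $ 0 + v $ i = 0"
      by (auto elim: hypE)
    have "v \<in> p" by (simp add: v(3) vec.span_base)
    then have "quartic v = 0" using p by (auto simp: X_def hypersurface_def)
    then obtain j where j: "j \<in> I5 - {i}" "s * v $ 0 - v $ j = 0"
      using quartic_on_hyperplane[OF assms v(4)] finite_I5 by auto
    then have "p \<in> hyp \<eta> (- s) j"
      unfolding v(3) span_singleton_in_hyp[OF v(1,2)] by simp
    then show "p \<in> (\<Union>j\<in>I5 - {i}. hyp \<eta> s i \<inter> hyp \<eta> (- s) j)"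
      using p j(1) by blast
  qed
  show "(\<Union>j\<in>I5 - {i}. hyp \<eta> s i \<inter> hyp \<eta> (- s) j) \<subseteq> hyp \<eta> s i \<inter> X \<eta>"
  proof
    fix p assume "p \<in> (\<Union>j\<in>I5 - {i}. hyp \<eta> s i \<inter> hyp \<eta> (- s) j)"
    then obtain j where j: "j \<in> I5 - {i}" and p: "p \<in> hyp \<eta> s i" "p \<in> hyp \<eta> (- s) j"
      by blast
    have "quartic x = 0" if "x \<in> p" for x
    proof -
      have "s * x $ 0 + x $ i = 0" "s * x $ 0 - x $ j = 0"
        using that p unfolding hyp_def hypersurface_def by auto
      then show ?thesis
        using quartic_on_hyperplane[OF assms, of x] j finite_I5 by auto
    qed
    then show "p \<in> hyp \<eta> s i \<inter> X \<eta>"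
      using p by (auto simp: hyp_def X_def hypersurface_def)
  qed
qed

lemma span_scale_eq:
  assumes "c \<noteq> (0 :: complex)"
  shows "vec.span {c *s v} = vec.span {v}"
proof -
  have "d *s v = (d / c) *s (c *s v)" for d
    using assms by (simp add: vector_smult_assoc)
  then show ?thesis
    unfolding set_eq_iff in_span_singleton by (metis vector_smult_assoc)
qed

section \<open>Counting the nodes on a hyperplane\<close>

text \<open>The inclusion from left to right uses only that a node is singular; the converse needs
  the nondegenerate Hessians at \<open>R\<close> and \<open>T\<close>. The second family runs over
  ordered pairs and so lists each point twice.\<close>

lemma hyp_Int_nodes:
  assumes i: "i \<in> I5" and s: "s\<^sup>2 = 1" and \<eta>: "\<eta>\<^sup>2 = -3"
  shows "hyp \<eta> s i \<inter> nodes (L \<eta>) quartic =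
     (\<lambda>(k, c). vec.span {R \<eta> s i k c}) ` (SIGMA k:I5 - {i}. I5 - {i} - {k})
   \<union> (\<lambda>(p, q). vec.span {T p q}) ` (SIGMA p:I5 - {i}. I5 - {i} - {p})"
    (is "?N = ?A \<union> ?B")
proof
  show "?N \<subseteq> ?A \<union> ?B"
  proof
    fix P assume P: "P \<in> ?N"
    then obtain v where v: "v \<in> L \<eta>" "v \<noteq> 0" "P = vec.span {v}" "is_singular (L \<eta>) quartic v"
      by (auto simp: nodes_def is_node_def)
    then have "s * v $ 0 + v $ i = 0"
      using P span_singleton_in_hyp by blast
    from singular_on_hyperplane[OF i s this v(1,4)]
    consider (R) k c where "k \<in> I5 - {i}" "c \<in> I5 - {i}" "k \<noteq> c" "v = (s * v $ 0) *s R \<eta> s i k c"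
      | (T) p q where "p \<in> I5 - {i}" "q \<in> I5 - {i}" "p \<noteq> q" "v = v $ p *s T p q"
      by blast
    then show "P \<in> ?A \<union> ?B"
    proof cases
      case R
      then have "s * v $ 0 \<noteq> 0" using v(2) by (metis vector_smult_lzero)
      then have "P = vec.span {R \<eta> s i k c}"
        using R(4) v(3) span_scale_eq by metis
      then show ?thesis using R(1-3) by force
    next
      case T
      then have "v $ p \<noteq> 0" using v(2) by (metis vector_smult_lzero)
      then have "P = vec.span {T p q}"
        using T(4) v(3) span_scale_eq by metis
      then show ?thesis using T(1-3) by force
    qed
  qed
  have "vec.span {R \<eta> s i k c} \<in> ?N" if "k \<in> I5 - {i}" "c \<in> I5 - {i} - {k}" for k c
  proof -
    have *: "k \<in> I5" "c \<in> I5" "distinct [i, k, c]" using that by auto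
    have "i \<noteq> 0" using i zero_notin_I5 by auto
    then have "R \<eta> s i k c $ 0 = s" "R \<eta> s i k c $ i = -1" by (simp_all add: R_nth)
    then have "s * R \<eta> s i k c $ 0 + R \<eta> s i k c $ i = 0"
      using s by (simp add: power2_eq_square)
    then show ?thesis
      using node_R[OF i * s \<eta>] span_singleton_in_hyp[OF R_in_L[OF i *] R_nonzero[OF s]] by blast
  qed
  moreover have "vec.span {T p q} \<in> ?N" if "p \<in> I5 - {i}" "q \<in> I5 - {i} - {p}" for p q
  proof -
    have *: "p \<in> I5" "q \<in> I5" "p \<noteq> q" using that by auto
    have "s * T p q $ 0 + T p q $ i = 0"
      using that zero_notin_I5 by (auto simp: T_nth)
    then show ?thesis
      using node_T[OF *] span_singleton_in_hyp[OF T_in_L[OF *(1,2)] T_nonzero[OF *(3)]] by blast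
  qed
  ultimately show "?A \<union> ?B \<subseteq> ?N" by auto
qed

text \<open>There are 4 * 3 pairs, and the point determines its pair: coordinate 0 fixes the scale,
  \<open>k\<close> is the place of -1 other than \<open>i\<close>, and \<open>c\<close> is the place
  of s \<eta>, which differs from 1 and -1.\<close>

lemma card_R:
  assumes i: "i \<in> I5" and s: "s\<^sup>2 = 1" and \<eta>: "\<eta>\<^sup>2 = -3"
  shows "card ((\<lambda>(k, c). vec.span {R \<eta> s i k c}) ` (SIGMA k:I5 - {i}. I5 - {i} - {k})) = 12"
proof -
  have "(s * \<eta>)\<^sup>2 = -3" using s \<eta> by (simp add: power_mult_distrib)
  then have ne: "s * \<eta> \<noteq> 1" "s * \<eta> \<noteq> -1" by auto
  have s0: "s \<noteq> 0" using s by auto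
  have *: "k = k' \<and> c = c'"
    if k: "k \<in> I5 - {i}" "c \<in> I5 - {i} - {k}" and k': "k' \<in> I5 - {i}" "c' \<in> I5 - {i} - {k'}"
      and eq: "vec.span {R \<eta> s i k c} = vec.span {R \<eta> s i k' c'}" for k c k' c'
  proof -
    have nz: "k \<noteq> 0" "c \<noteq> 0" using k zero_notin_I5 by auto
    have "R \<eta> s i k c \<in> vec.span {R \<eta> s i k' c'}"
      using eq vec.span_base by blast
    then obtain d where d: "R \<eta> s i k c = d *s R \<eta> s i k' c'"
      by (auto simp: in_span_singleton)
    then have "R \<eta> s i k c $ 0 = d * R \<eta> s i k' c' $ 0" by simp
    then have "d = 1" using s0 by (simp add: R_nth)
    then have R: "R \<eta> s i k c $ r = R \<eta> s i k' c' $ r" for r using d by simp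
    have "k = k'" using R[of k] nz k ne by (auto simp: R_nth split: if_splits)
    moreover have "c = c'" using R[of c] nz k ne calculation by (auto simp: R_nth split: if_splits)
    ultimately show ?thesis ..
  qed
  have "inj_on (\<lambda>(k, c). vec.span {R \<eta> s i k c}) (SIGMA k:I5 - {i}. I5 - {i} - {k})"
  proof (rule inj_onI)
    fix x y assume xy: "x \<in> (SIGMA k:I5 - {i}. I5 - {i} - {k})" "y \<in> (SIGMA k:I5 - {i}. I5 - {i} - {k})"
      and eq: "(case x of (k, c) \<Rightarrow> vec.span {R \<eta> s i k c}) = (case y of (k, c) \<Rightarrow> vec.span {R \<eta> s i k c})"
    obtain k c k' c' where [simp]: "x = (k, c)" "y = (k', c')" by fastforce
    show "x = y" using *[of k c k' c'] xy eq unfolding mem_Sigma_iff by simp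
  qed
  then show ?thesis
    using i finite_I5 by (simp add: card_image card_I5)
qed

lemma card_T:
  assumes i: "i \<in> I5"
  shows "card ((\<lambda>(p, q). vec.span {T p q}) ` (SIGMA p:I5 - {i}. I5 - {i} - {p})) = 6"
    (is "card ?B = 6")
proof -
  \<comment> \<open>The support of a line forgets the sign between \<open>T p q\<close> and
    \<open>T q p\<close>, so it identifies these points with the two-element subsets of a set of
    four indices.\<close>
  define supp :: "(complex ^ 6) set \<Rightarrow> 6 set" where "supp P = {r. \<exists>x\<in>P. x $ r \<noteq> 0}" for P
  have supp: "supp (vec.span {T p q}) = {p, q}" if "p \<noteq> q" for p q
  proof
    have "x $ r = 0" if "x \<in> vec.span {T p q}" "r \<notin> {p, q}" for x r
      using that by (auto simp: in_span_singleton T_nth)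
    then show "supp (vec.span {T p q}) \<subseteq> {p, q}"
      unfolding supp_def by blast
    have "T p q \<in> vec.span {T p q}" "T p q $ p \<noteq> 0" "T p q $ q \<noteq> 0"
      using that by (simp_all add: T_nth vec.span_base)
    then show "{p, q} \<subseteq> supp (vec.span {T p q})"
      unfolding supp_def by blast
  qed
  have swap: "vec.span {T q p} = vec.span {T p q}" for p q
  proof -
    have "(-1) *s T p q = T q p"
      by (simp add: vec_eq_iff T_nth)
    then show ?thesis using span_scale_eq[of "-1" "T p q"] by simp
  qed
  have "inj_on supp ?B"
  proof (rule inj_onI)
    fix P Q assume "P \<in> ?B" "Q \<in> ?B" and eq: "supp P = supp Q"
    then obtain p q p' q' where "P = vec.span {T p q}" "p \<noteq> q" "Q = vec.span {T p' q'}" "p' \<noteq> q'"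
      by auto
    moreover from this have "p = p' \<and> q = q' \<or> p = q' \<and> q = p'"
      using eq by (simp add: supp doubleton_eq_iff)
    ultimately show "P = Q" using swap by metis
  qed
  then have "card ?B = card (supp ` ?B)" by (simp add: card_image)
  also have "supp ` ?B = {C. C \<subseteq> I5 - {i} \<and> card C = 2}"
  proof
    show "supp ` ?B \<subseteq> {C. C \<subseteq> I5 - {i} \<and> card C = 2}"
      by (auto simp: supp)
    show "{C. C \<subseteq> I5 - {i} \<and> card C = 2} \<subseteq> supp ` ?B"
    proof
      fix C assume "C \<in> {C. C \<subseteq> I5 - {i} \<and> card C = 2}"
      then obtain p q where C: "C = {p, q}" "p \<noteq> q" "{p, q} \<subseteq> I5 - {i}"
        by (auto simp: card_2_iff)
      then have "vec.span {T p q} \<in> ?B" by force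
      then have "supp (vec.span {T p q}) \<in> supp ` ?B" by (rule imageI)
      then show "C \<in> supp ` ?B" unfolding supp[OF C(2)] C(1) .
    qed
  qed
  also have "card \<dots> = 6"
    using i finite_I5 by (simp add: n_subsets card_I5 eval_nat_numeral)
  finally show ?thesis .
qed

lemma card_hyp_Int_nodes:
  assumes "i \<in> I5" "s\<^sup>2 = 1" "\<eta>\<^sup>2 = -3"
  shows "card (hyp \<eta> s i \<inter> nodes (L \<eta>) quartic) = 18"
proof -
  let ?A = "(\<lambda>(k, c). vec.span {R \<eta> s i k c}) ` (SIGMA k:I5 - {i}. I5 - {i} - {k})"
  let ?B = "(\<lambda>(p, q). vec.span {T p q}) ` (SIGMA p:I5 - {i}. I5 - {i} - {p})"
  have "\<exists>x\<in>P. x $ 0 \<noteq> 0" if "P \<in> ?A" for P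
  proof -
    from that obtain k c where "P = vec.span {R \<eta> s i k c}" by auto
    then have "R \<eta> s i k c \<in> P" by (simp add: vec.span_base)
    moreover have "R \<eta> s i k c $ 0 \<noteq> 0" using assms(2) by (auto simp: R_nth)
    ultimately show ?thesis by blast
  qed
  moreover have "x $ 0 = 0" if "P \<in> ?B" "x \<in> P" for P x
  proof -
    from that obtain p q where "P = vec.span {T p q}" "p \<noteq> 0" "q \<noteq> 0"
      using zero_notin_I5 by (auto simp del: vec.span_singleton)
    then show ?thesis using that(2) by (auto simp: in_span_singleton T_nth)
  qed
  \<comment> \<open>The two types are separated by a \<noteq> 0 and a = 0, so the counts 12 and 6
    add up.\<close>
  ultimately have "?A \<inter> ?B = {}" by (meson disjoint_iff)
  then show ?thesis
    unfolding hyp_Int_nodes[OF assms]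
    using card_R[OF assms] card_T[OF assms(1)] finite_I5 by (simp add: card_Un_disjoint)
qed

section \<open>The ten hyperplanes are genuine and pairwise distinct\<close>

lemma hyp_inject:
  assumes \<eta>: "\<eta>\<^sup>2 = -3" and "s \<in> {1, -1}" "s' \<in> {1, -1}" "i \<in> I5" "j \<in> I5"
    and eq: "hyp \<eta> s i = hyp \<eta> s' j"
  shows "s = s' \<and> i = j"
proof -
  \<comment> \<open>a representative of a point of this hyperplane that lies on none of the other nine\<close>
  define w :: "complex ^ 6" where
    "w = (\<chi> r. if r = 0 then 1 else if r = i then - s else (\<eta> + s) / 4)"
  have i0: "i \<noteq> 0" "j \<noteq> 0" using assms zero_notin_I5 by auto
  have w_0: "w $ 0 = 1" and w_i: "w $ i = - s" using i0 by (simp_all add: w_def)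
  \<comment> \<open>Four equal coordinates (\<eta> + s) / 4 compensate u_i = -s, so that the sum is
    \<eta>.\<close>
  have "(\<Sum>r\<in>I5. w $ r) = w $ i + (\<Sum>r\<in>I5 - {i}. w $ r)"
    using assms(4) finite_I5 by (rule sum.remove[rotated])
  also have "(\<Sum>r\<in>I5 - {i}. w $ r) = (\<Sum>r\<in>I5 - {i}. (\<eta> + s) / 4)"
    using zero_notin_I5 by (intro sum.cong) (auto simp: w_def)
  finally have w: "w \<in> L \<eta>"
    using assms(4) finite_I5 i0 by (simp add: L_def card_I5 w_i w_0 field_simps)
  have w0: "w \<noteq> 0" using w_0 by auto
  have "vec.span {w} \<in> hyp \<eta> s i"
    unfolding span_singleton_in_hyp[OF w w0] using i0 by (simp add: w_def)
  then have *: "s' + w $ j = 0"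
    unfolding eq span_singleton_in_hyp[OF w w0] by (simp add: w_def)
  show ?thesis
  proof (cases "i = j")
    case True
    then show ?thesis using * i0 by (simp add: w_def)
  next
    case False
    \<comment> \<open>With both signs in {1, -1} this would make \<eta> one of 3, -3, 5, -5.\<close>
    then have "\<eta> = - (4 * s' + s)"
      using * i0 by (simp add: w_def field_simps add_eq_0_iff)
    then have "\<eta>\<^sup>2 = 25 \<or> \<eta>\<^sup>2 = 9" using assms(2,3) by auto
    then show ?thesis using \<eta> by auto
  qed
qed

lemma is_hyperplane_hyp:
  assumes "i \<in> I5"
  shows "is_hyperplane (L \<eta>) (hyp \<eta> s i)"
proof -
  have "Vector_Spaces.linear (*s) (*) (\<lambda>x :: complex ^ 6. s * x $ 0 + x $ i)"
    by unfold_locales (simp_all add: algebra_simps)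
  moreover have "I5 - {i} \<noteq> {}" by (auto simp: I5_def)
  then obtain j where "j \<in> I5" "j \<noteq> i" by blast
  \<comment> \<open>At \<open>T i j\<close> the linear form takes the value 1, so it does not vanish
    identically on \<open>L \<eta>\<close>.\<close>
  then have "T i j \<in> L \<eta>" "s * T i j $ 0 + T i j $ i \<noteq> 0"
    using assms T_in_L zero_notin_I5 by (auto simp: T_nth)
  ultimately show ?thesis
    unfolding is_hyperplane_def hyp_def by blast
qed

section \<open>Projective equivalence with the Burkhardt quartic\<close>

text \<open>The left-hand side is \<open>\<sigma>\<^sub>4(2t, u\<^sub>1 - t, \<dots>, u\<^sub>5 - t)\<close>.\<close>

lemma esym_shift:
  fixes u\<^sub>1 u\<^sub>2 u\<^sub>3 u\<^sub>4 u\<^sub>5 t :: complex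
  shows "(u\<^sub>1 - t) * (u\<^sub>2 - t) * (u\<^sub>3 - t) * (u\<^sub>4 - t) + (u\<^sub>1 - t) * (u\<^sub>2 - t) * (u\<^sub>3 - t) * (u\<^sub>5 - t)
    + (u\<^sub>1 - t) * (u\<^sub>2 - t) * (u\<^sub>4 - t) * (u\<^sub>5 - t) + (u\<^sub>1 - t) * (u\<^sub>3 - t) * (u\<^sub>4 - t) * (u\<^sub>5 - t)
    + (u\<^sub>2 - t) * (u\<^sub>3 - t) * (u\<^sub>4 - t) * (u\<^sub>5 - t)
    + 2 * t * ((u\<^sub>1 - t) * (u\<^sub>2 - t) * (u\<^sub>3 - t) + (u\<^sub>1 - t) * (u\<^sub>2 - t) * (u\<^sub>4 - t)
      + (u\<^sub>1 - t) * (u\<^sub>2 - t) * (u\<^sub>5 - t) + (u\<^sub>1 - t) * (u\<^sub>3 - t) * (u\<^sub>4 - t)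
      + (u\<^sub>1 - t) * (u\<^sub>3 - t) * (u\<^sub>5 - t) + (u\<^sub>1 - t) * (u\<^sub>4 - t) * (u\<^sub>5 - t)
      + (u\<^sub>2 - t) * (u\<^sub>3 - t) * (u\<^sub>4 - t) + (u\<^sub>2 - t) * (u\<^sub>3 - t) * (u\<^sub>5 - t)
      + (u\<^sub>2 - t) * (u\<^sub>4 - t) * (u\<^sub>5 - t) + (u\<^sub>3 - t) * (u\<^sub>4 - t) * (u\<^sub>5 - t))
    = u\<^sub>1 * u\<^sub>2 * u\<^sub>3 * u\<^sub>4 + u\<^sub>1 * u\<^sub>2 * u\<^sub>3 * u\<^sub>5 + u\<^sub>1 * u\<^sub>2 * u\<^sub>4 * u\<^sub>5 + u\<^sub>1 * u\<^sub>3 * u\<^sub>4 * u\<^sub>5 + u\<^sub>2 * u\<^sub>3 * u\<^sub>4 * u\<^sub>5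
    - 3 * t\<^sup>2 * (u\<^sub>1 * u\<^sub>2 + u\<^sub>1 * u\<^sub>3 + u\<^sub>1 * u\<^sub>4 + u\<^sub>1 * u\<^sub>5 + u\<^sub>2 * u\<^sub>3 + u\<^sub>2 * u\<^sub>4 + u\<^sub>2 * u\<^sub>5 + u\<^sub>3 * u\<^sub>4 + u\<^sub>3 * u\<^sub>5 + u\<^sub>4 * u\<^sub>5)
    + 8 * t ^ 3 * (u\<^sub>1 + u\<^sub>2 + u\<^sub>3 + u\<^sub>4 + u\<^sub>5) - 15 * t ^ 4"
  by algebra

text \<open>Put t = (\<eta> / 3) a. Then 3 t^2 = -a^2, and on \<open>L \<eta>\<close> the sum of the
  u_i is 3 t. In \<open>esym_shift\<close> this produces the term a^2 e_2, while 24 t^4 - 15 t^4 = 9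
  t^4 = a^4 gives the rest. Also \<sigma>_1 pulls back to the equation of
  \<open>L \<eta>\<close>.\<close>

lemma is_Burkhardt_quartic:
  assumes \<eta>: "\<eta>\<^sup>2 = -3"
  shows "is_Burkhardt (L \<eta>) quartic"
proof -
  define M :: "complex ^ 6 ^ 6" where
    "M = (\<chi> r c. if r = c then if r = 0 then 2 * (\<eta> / 3) else 1 else if c = 0 then - (\<eta> / 3) else 0)"
  have lab: "labelling 1 2 3 4 5"
    by (simp add: labelling_def I5_def)
  have Mx: "(M *v x) $ r = (if r = 0 then 2 * (\<eta> / 3 * x $ 0) else x $ r - \<eta> / 3 * x $ 0)" for x r
  proof -
    have "(M *v x) $ r = M $ r $ 0 * x $ 0 + (\<Sum>c\<in>I5. M $ r $ c * x $ c)"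
    proof -
      have "(M *v x) $ r = (\<Sum>c\<in>UNIV. M $ r $ c * x $ c)"
        by (simp add: matrix_vector_mult_def)
      then show ?thesis using finite_I5 zero_notin_I5 by (simp add: UNIV_eq_insert_I5)
    qed
    also have "(\<Sum>c\<in>I5. M $ r $ c * x $ c) = (\<Sum>c\<in>I5. if r = c then x $ c else 0)"
      using zero_notin_I5 by (intro sum.cong) (auto simp: M_def)
    also have "\<dots> = (if r = 0 then 0 else x $ r)"
      using finite_I5 by (simp add: in_I5_iff)
    finally show ?thesis by (simp add: M_def)
  qed
  have \<eta>0: "\<eta> \<noteq> 0" using \<eta> by auto
  have e1: "esym UNIV 1 y = y $ 0 + (\<Sum>r\<in>I5. y $ r)" for y :: "complex ^ 6"
    unfolding UNIV_6 sum_labelling[OF lab] by (simp add: esym_insert esym_0 esym_empty)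
  have e4: "esym UNIV 4 y =
      y $ 1 * y $ 2 * y $ 3 * y $ 4 + y $ 1 * y $ 2 * y $ 3 * y $ 5 + y $ 1 * y $ 2 * y $ 4 * y $ 5
      + y $ 1 * y $ 3 * y $ 4 * y $ 5 + y $ 2 * y $ 3 * y $ 4 * y $ 5
      + y $ 0 * (y $ 1 * y $ 2 * y $ 3 + y $ 1 * y $ 2 * y $ 4 + y $ 1 * y $ 2 * y $ 5
        + y $ 1 * y $ 3 * y $ 4 + y $ 1 * y $ 3 * y $ 5 + y $ 1 * y $ 4 * y $ 5
        + y $ 2 * y $ 3 * y $ 4 + y $ 2 * y $ 3 * y $ 5 + y $ 2 * y $ 4 * y $ 5 + y $ 3 * y $ 4 * y $ 5)"
    for y :: "complex ^ 6"
    unfolding UNIV_6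
    by (simp add: eval_nat_numeral esym_insert esym_0 esym_empty algebra_simps)
  have M_L: "esym UNIV 1 (M *v x) = (\<Sum>r\<in>I5. x $ r) - \<eta> * x $ 0" for x
    unfolding e1 sum_labelling[OF lab] Mx by (simp add: algebra_simps)
  have "inj ((*v) M)"
  proof (rule injI)
    fix x y assume "M *v x = M *v y"
    then have *: "(M *v x) $ r = (M *v y) $ r" for r by simp
    have "x $ 0 = y $ 0" using *[of 0] \<eta>0 by (simp add: Mx)
    then have "x $ r = y $ r" for r using *[of r] by (cases "r = 0") (simp_all add: Mx)
    then show "x = y" by (simp add: vec_eq_iff)
  qed
  then have "invertible M"
    unfolding invertible_left_inverse matrix_left_invertible_injective .
  moreover have "(*v) M ` L \<eta> = {x :: complex ^ 6. esym UNIV 1 x = 0}"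
  proof
    show "(*v) M ` L \<eta> \<subseteq> {x :: complex ^ 6. esym UNIV 1 x = 0}"
      using M_L by (auto simp: L_def)
    show "{x :: complex ^ 6. esym UNIV 1 x = 0} \<subseteq> (*v) M ` L \<eta>"
    proof
      fix y :: "complex ^ 6" assume "y \<in> {x :: complex ^ 6. esym UNIV 1 x = 0}"
      \<comment> \<open>The inverse map: y_0 = 2 t gives t = y_0 / 2, hence a = 3 t / \<eta> and u_r
        = y_r + t.\<close>
      moreover define x :: "complex ^ 6" where
        "x = (\<chi> r. if r = 0 then 3 / (2 * \<eta>) * y $ 0 else y $ r + y $ 0 / 2)"
      have "y = M *v x"
        unfolding vec_eq_iff Mx using \<eta>0 by (simp add: x_def)
      ultimately show "y \<in> (*v) M ` L \<eta>"
        using M_L[of x] by (auto simp: L_def)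
    qed
  qed
  moreover have "quartic x = 1 * esym UNIV 4 (M *v x)" if "x \<in> L \<eta>" for x
  proof -
    define t where "t = \<eta> / 3 * x $ 0"
    have y: "(M *v x) $ r = (if r = 0 then 2 * t else x $ r - t)" for r
      by (simp add: Mx t_def)
    have t2: "3 * t\<^sup>2 = - (x $ 0)\<^sup>2"
      using \<eta> by (simp add: t_def power_mult_distrib power_divide)
    have "9 * t ^ 4 = (3 * t\<^sup>2)\<^sup>2" by (simp add: power_mult_distrib flip: power_mult)
    then have t4: "9 * t ^ 4 = x $ 0 ^ 4" unfolding t2 by (simp flip: power_mult)
    have sum: "x $ 1 + x $ 2 + x $ 3 + x $ 4 + x $ 5 = 3 * t"
      using that unfolding L_def sum_labelling[OF lab] by (simp add: t_def)
    have t34: "8 * t ^ 3 * (3 * t) - 15 * t ^ 4 = 9 * t ^ 4" by algebra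
    have y0: "(M *v x) $ 0 = 2 * t" "(M *v x) $ 1 = x $ 1 - t" "(M *v x) $ 2 = x $ 2 - t"
      "(M *v x) $ 3 = x $ 3 - t" "(M *v x) $ 4 = x $ 4 - t" "(M *v x) $ 5 = x $ 5 - t"
      by (simp_all add: y)
    show ?thesis
      \<comment> \<open>Reassociating with \<open>add_diff_eq[symmetric]\<close> brings the two pure
        powers of \<open>t\<close> together, where \<open>t34\<close> applies.\<close>
      unfolding e4 y0 esym_shift sum quartic_labelling[OF lab] t2 add_diff_eq[symmetric] t34 t4
      by (simp add: algebra_simps)
  qed
  ultimately show ?thesis
    unfolding is_Burkhardt_def proj_equivalent_def
    by (intro exI[of _ M] exI[of _ 1]) simp
qed

section \<open>Both families as the two signs of \<open>hyp\<close>\<close>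

theorem proposition7p1:
  fixes \<eta> :: complex
  assumes "\<eta>\<^sup>2 = -3"
  shows "(\<forall>i\<in>I5. F \<eta> i \<inter> X \<eta> = (\<Union>j\<in>I5 - {i}. Pi_plane \<eta> i j)
               \<and> G \<eta> i \<inter> X \<eta> = (\<Union>j\<in>I5 - {i}. Pi_plane \<eta> j i))
    \<and> (\<forall>i\<in>I5. card (F \<eta> i \<inter> nodes (L \<eta>) quartic) = 18
               \<and> card (G \<eta> i \<inter> nodes (L \<eta>) quartic) = 18)
    \<and> card (F \<eta> ` I5 \<union> G \<eta> ` I5) = 10
    \<and> (\<forall>H \<in> F \<eta> ` I5 \<union> G \<eta> ` I5. is_Steiner_hyperplane (L \<eta>) quartic H)"
proof (intro conjI)
  note hyp = F_eq_hyp G_eq_hyp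
  show "\<forall>i\<in>I5. F \<eta> i \<inter> X \<eta> = (\<Union>j\<in>I5 - {i}. Pi_plane \<eta> i j)
      \<and> G \<eta> i \<inter> X \<eta> = (\<Union>j\<in>I5 - {i}. Pi_plane \<eta> j i)"
  proof (intro ballI conjI)
    fix i assume i: "i \<in> I5"
    show "F \<eta> i \<inter> X \<eta> = (\<Union>j\<in>I5 - {i}. Pi_plane \<eta> i j)"
      using hyp_Int_X[OF i, of 1 \<eta>] unfolding hyp Pi_plane_def by simp
    show "G \<eta> i \<inter> X \<eta> = (\<Union>j\<in>I5 - {i}. Pi_plane \<eta> j i)"
      using hyp_Int_X[OF i, of "-1" \<eta>] unfolding hyp Pi_plane_def
      by (simp add: Int_commute[of "hyp \<eta> 1 _"])
  qed
  show card: "\<forall>i\<in>I5. card (F \<eta> i \<inter> nodes (L \<eta>) quartic) = 18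
      \<and> card (G \<eta> i \<inter> nodes (L \<eta>) quartic) = 18"
    using card_hyp_Int_nodes[OF _ _ assms] unfolding hyp by simp
  \<comment> \<open>Injectivity on pairs of sign and index also excludes that some \<open>F\<close>
    equals some \<open>G\<close>.\<close>
  have "inj_on (\<lambda>(s, i). hyp \<eta> s i) ({1, -1} \<times> I5)"
  proof (rule inj_onI, clarify)
    fix s s' i j assume "s \<in> {1, -1}" "s' \<in> {1, -1}" "i \<in> I5" "j \<in> I5" "hyp \<eta> s i = hyp \<eta> s' j"
    then show "s = s' \<and> i = j" by (rule hyp_inject[OF assms])
  qed
  then have "card ((\<lambda>(s, i). hyp \<eta> s i) ` ({1, -1} \<times> I5)) = 10"
    by (simp add: card_image card_cartesian_product card_I5)
  moreover have "(\<lambda>(s, i). hyp \<eta> s i) ` ({1, -1} \<times> I5) = F \<eta> ` I5 \<union> G \<eta> ` I5"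
    unfolding hyp by fastforce
  ultimately show "card (F \<eta> ` I5 \<union> G \<eta> ` I5) = 10" by simp
  have "is_Steiner_hyperplane (L \<eta>) quartic (hyp \<eta> s i)" if "i \<in> I5" "s\<^sup>2 = 1" for s i
    unfolding is_Steiner_hyperplane_def
    using is_Burkhardt_quartic[OF assms] is_hyperplane_hyp[OF that(1)] card_hyp_Int_nodes[OF that assms]
    by blast
  then show "\<forall>H \<in> F \<eta> ` I5 \<union> G \<eta> ` I5. is_Steiner_hyperplane (L \<eta>) quartic H"
    unfolding hyp by (simp add: ball_Un)
qed

end
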